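(* Let $R_1$ be the ring generated over $\mathbb{Z}$ by the recursively defined transformations $s=\begin{pmatrix}1&0\\0&2s\end{pmatrix}$ and $t=\begin{pmatrix}0&2s\\0&2t\end{pmatrix}$ (as made precise in the context). Then $R_1$ is isomorphic to the free $2$-generated ring, i.e. to the free associative unital ring $\mathbb{Z}\langle x,y\rangle$ on two non-commuting generators.
   Context: Let $S$ be the set of all finite words (including the empty word $\phi$) on the alphabet $\{y_1,y_2\}$, and let $V$ be the $\mathbb{Q}$-vector space with basis $S$. Linear operators act on the right (so $ab$ means first $a$, then $b$). A linear operator $L$ on $V$ preserving the span of words of each fixed length is given by a scalar $L_\phi$ with $(\phi)L=L_\phi\phi$ and operators $L_{ij}$ ($i,j\in\{1,2\}$) of the same kind with $(y_iu)L=\sum_{j}y_j\cdot(u)L_{ij}$ for all $u\in S$; one writes $L=\begin{pmatrix}L_{11}&L_{12}\\L_{21}&L_{22}\end{pmatrix}$. The operators $s,t$ are the unique ones with $s_\phi=1$, $t_\phi=0$ and the displayed recursive block forms, i.e. for all $u\in S$: $(\phi)s=\phi$, $(y_1u)s=y_1u$, $(y_2u)s=2\,y_2\cdot(u)s$; $(\phi)t=0$, $(y_1u)t=2\,y_2\cdot(u)s$, $(y_2u)t=2\,y_2\cdot(u)t$. Here $R_1$ is the subring of $\mathrm{End}_{\mathbb{Q}}(V)$ of all $\mathbb{Z}$-linear combinations of products of $s$ and $t$, including the empty product (the identity). *)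

theory Defs
  imports "HOL-Library.Poly_Mapping" "HOL-Algebra.Generated_Rings" "HOL-Algebra.Algebraic_Closure_Type"
begin

text \<open>
  The free monoid, written additively because the library's convolution product on
  \<open>'m \<Rightarrow>\<^sub>0 'r\<close> expects the monoid of exponents in class \<open>monoid_add\<close>.  The addition is
  concatenation, hence not commutative.
\<close>

datatype 'a free_monoid = FWord "'a list"

instantiation free_monoid :: (type) monoid_add
begin

definition zero_free_monoid :: "'a free_monoid"
  where "zero_free_monoid = FWord []"

fun plus_free_monoid :: "'a free_monoid \<Rightarrow> 'a free_monoid \<Rightarrow> 'a free_monoid"
  where "plus_free_monoid (FWord u) (FWord v) = FWord (u @ v)"

instance
proof
  fix a b c :: "'a free_monoid"
  show "a + b + c = a + (b + c)" by (cases a; cases b; cases c) simp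
  show "0 + a = a" "a + 0 = a" by (cases a; simp add: zero_free_monoid_def)+
qed

end

text \<open>The free associative unital ring on \<open>'a\<close> is the integral monoid ring of the free monoid.\<close>

definition free_ring :: "('a free_monoid \<Rightarrow>\<^sub>0 int) ring"
  where "free_ring = ring_of_type_algebra"

lemma ring_free_ring: "ring (free_ring :: ('a free_monoid \<Rightarrow>\<^sub>0 int) ring)"
proof -
  have "\<exists>y. x + y = 0" for x :: "'a free_monoid \<Rightarrow>\<^sub>0 int"
    using add.right_inverse by blast
  then show ?thesis
    unfolding free_ring_def ring_of_type_algebra_def using add.right_inverse
    by unfold_locales (auto simp: algebra_simps Units_def)
qed

datatype gen = GenX | GenY

datatype letter = Y1 | Y2

type_synonym V = "letter list \<Rightarrow>\<^sub>0 rat"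

definition scale :: "rat \<Rightarrow> V \<Rightarrow> V"
  where "scale c v = Poly_Mapping.map ((*) c) v"

lemma lookup_scale [simp]: "poly_mapping.lookup (scale c v) u = c * poly_mapping.lookup v u"
  unfolding scale_def by transfer (simp add: when_def)

global_interpretation V: vector_space scale
  by unfold_locales (auto intro!: poly_mapping_eqI simp: lookup_add algebra_simps)

definition word :: "letter list \<Rightarrow> V"
  where "word u = Poly_Mapping.single u 1"

definition lin_ext :: "(letter list \<Rightarrow> V) \<Rightarrow> V \<Rightarrow> V"
  where "lin_ext b v = (\<Sum>u\<in>Poly_Mapping.keys v. scale (poly_mapping.lookup v u) (b u))"

lemma lin_ext_superset:
  assumes "finite A" "Poly_Mapping.keys v \<subseteq> A"
  shows "lin_ext b v = (\<Sum>u\<in>A. scale (poly_mapping.lookup v u) (b u))"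
  unfolding lin_ext_def using assms
  by (intro sum.mono_neutral_left) (auto simp: in_keys_iff)

lemma linear_lin_ext: "Vector_Spaces.linear scale scale (lin_ext b)"
proof -
  have "lin_ext b (v + w) = lin_ext b v + lin_ext b w" for v w
  proof -
    let ?A = "Poly_Mapping.keys v \<union> Poly_Mapping.keys w"
    have "Poly_Mapping.keys (v + w) \<subseteq> ?A" by (rule Poly_Mapping.keys_add)
    then show ?thesis
      by (simp add: lin_ext_superset[of ?A] lookup_add V.scale_left_distrib sum.distrib)
  qed
  moreover have "lin_ext b (scale c v) = scale c (lin_ext b v)" for c v
  proof -
    have "Poly_Mapping.keys (scale c v) \<subseteq> Poly_Mapping.keys v" by (auto simp: in_keys_iff)
    then show ?thesis
      by (simp add: lin_ext_superset[of "Poly_Mapping.keys v"] V.scale_sum_right)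
  qed
  ultimately show ?thesis
    by unfold_locales auto
qed

lemma lin_ext_word [simp]: "lin_ext b (word u) = b u"
  unfolding lin_ext_def word_def by simp

lemma lin_ext_unique:
  assumes "Vector_Spaces.linear scale scale L"
  shows "L = lin_ext (\<lambda>u. L (word u))"
proof
  fix v
  interpret L: Vector_Spaces.linear scale scale L by fact
  have "v = (\<Sum>u\<in>Poly_Mapping.keys v. scale (poly_mapping.lookup v u) (word u))"
    by (rule poly_mapping_eqI)
      (simp add: lookup_sum word_def lookup_single when_def if_distrib[of "(*) _"] in_keys_iff
        cong: if_cong)
  then have "L v = L (\<Sum>u\<in>Poly_Mapping.keys v. scale (poly_mapping.lookup v u) (word u))" by simp
  also have "\<dots> = lin_ext (\<lambda>u. L (word u)) v"
    by (simp add: L.sum L.scale lin_ext_def)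
  finally show "L v = lin_ext (\<lambda>u. L (word u)) v" .
qed

text \<open>\<open>prefix y v\<close> is \<open>y \<cdot> v\<close>, left concatenation by the letter \<open>y\<close>, extended linearly.\<close>

definition prefix :: "letter \<Rightarrow> V \<Rightarrow> V"
  where "prefix y = lin_ext (\<lambda>u. word (y # u))"

fun s_word :: "letter list \<Rightarrow> V" where
  "s_word [] = word []"
| "s_word (Y1 # u) = word (Y1 # u)"
| "s_word (Y2 # u) = scale 2 (prefix Y2 (s_word u))"

definition op_s :: "V \<Rightarrow> V"
  where "op_s = lin_ext s_word"

fun t_word :: "letter list \<Rightarrow> V" where
  "t_word [] = 0"
| "t_word (Y1 # u) = scale 2 (prefix Y2 (s_word u))"
| "t_word (Y2 # u) = scale 2 (prefix Y2 (t_word u))"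

definition op_t :: "V \<Rightarrow> V"
  where "op_t = lin_ext t_word"

text \<open>\<open>op_s\<close> and \<open>op_t\<close> are the unique linear operators satisfying the recursive block equations.\<close>

lemma op_s_unique:
  "Vector_Spaces.linear scale scale L \<and>
   L (word []) = word [] \<and>
   (\<forall>u. L (word (Y1 # u)) = word (Y1 # u)) \<and>
   (\<forall>u. L (word (Y2 # u)) = scale 2 (prefix Y2 (L (word u))))
   \<longleftrightarrow> L = op_s" (is "?P \<longleftrightarrow> _")
proof
  assume P: ?P
  have "L (word u) = s_word u" for u
    by (induction u rule: s_word.induct) (use P in simp_all)
  then show "L = op_s"
    using P lin_ext_unique[of L] by (simp add: op_s_def)
qed (simp add: op_s_def linear_lin_ext)

lemma op_t_unique:
  "Vector_Spaces.linear scale scale L \<and>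
   L (word []) = 0 \<and>
   (\<forall>u. L (word (Y1 # u)) = scale 2 (prefix Y2 (op_s (word u)))) \<and>
   (\<forall>u. L (word (Y2 # u)) = scale 2 (prefix Y2 (L (word u))))
   \<longleftrightarrow> L = op_t" (is "?P \<longleftrightarrow> _")
proof
  assume P: ?P
  have "L (word u) = t_word u" for u
    by (induction u rule: t_word.induct) (use P in \<open>simp_all add: op_s_def\<close>)
  then show "L = op_t"
    using P lin_ext_unique[of L] by (simp add: op_t_def)
qed (simp add: op_s_def op_t_def linear_lin_ext)

text \<open>Operators act on the right, so the product \<open>a b\<close> is first \<open>a\<close>, then \<open>b\<close>.\<close>

definition End_V :: "(V \<Rightarrow> V) ring"
  where "End_V = \<lparr>
    carrier = {f. Vector_Spaces.linear scale scale f},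
    monoid.mult = (\<lambda>a b. b \<circ> a),
    one = id,
    ring.zero = (\<lambda>_. 0),
    add = (\<lambda>a b v. a v + b v)\<rparr>"

lemma linear_iff_V:
  "Vector_Spaces.linear scale scale f \<longleftrightarrow>
   (\<forall>v w. f (v + w) = f v + f w) \<and> (\<forall>c v. f (scale c v) = scale c (f v))"
  by (simp add: Vector_Spaces.linear_iff V.vector_space_axioms)

lemma ring_End_V: "ring End_V"
proof (rule ringI)
  show "abelian_group End_V"
  proof (rule abelian_groupI)
    fix f assume "f \<in> carrier End_V"
    then show "\<exists>g\<in>carrier End_V. g \<oplus>\<^bsub>End_V\<^esub> f = \<zero>\<^bsub>End_V\<^esub>"
      by (intro bexI[of _ "\<lambda>v. - f v"]) (auto simp: End_V_def linear_iff_V)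
  qed (auto simp: End_V_def linear_iff_V V.scale_right_distrib fun_eq_iff algebra_simps)
  show "monoid End_V"
    by (rule monoidI) (auto simp: End_V_def linear_iff_V)
qed (auto simp: End_V_def linear_iff_V comp_def)

lemma op_s_op_t_in_End_V: "op_s \<in> carrier End_V" "op_t \<in> carrier End_V"
  by (simp_all add: End_V_def op_s_def op_t_def linear_lin_ext)

definition R1 :: "(V \<Rightarrow> V) ring"
  where "R1 = End_V \<lparr>carrier := generate_ring End_V {op_s, op_t}\<rparr>"

end

theory Submission
  imports Defs
begin

text \<open>
  On a word \<open>y\<^sub>2\<^bsup>k\<^esup>y\<^sub>1y\<^sub>2\<^bsup>l\<^esup>u\<close>, with \<open>u\<close> empty or starting with \<open>y\<^sub>1\<close>, the operator \<open>s\<close> acts as the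
  scalar \<open>2\<^bsup>k\<^esup>\<close>, while \<open>t\<close> returns \<open>2\<^bsup>k+1+l\<^esup>\<close> times the word \<open>y\<^sub>2\<^bsup>k+1+l\<^esup>u\<close>. Hence a monomial in
  \<open>s\<close> and \<open>t\<close> maps every word with enough occurrences of \<open>y\<^sub>1\<close> to a power of \<open>2\<close> times a word. If
  the successive lengths of the leading block are \<open>M, M D, M D\<^sup>2, \<dots>\<close>, then the exponent of this
  power is \<open>M\<close> times a number from whose base \<open>D\<close> digits the monomial can be read off, provided
  that \<open>D\<close> exceeds its degree. So if a combination \<open>\<Sum> c\<^sub>w w\<close> of monomials acts as zero, applying it to
  this one word and adding up coefficients gives \<open>\<Sum> c\<^sub>w (2\<^sup>M)\<^bsup>e(w)\<^esup> = 0\<close> with distinct exponents,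
  which forces all \<open>c\<^sub>w = 0\<close> as soon as \<open>2\<^sup>M\<close> exceeds all \<open>\<bar>c\<^sub>w\<bar>\<close>.
\<close>

subsection \<open>The evaluation homomorphism\<close>

fun gen_op :: "gen \<Rightarrow> V \<Rightarrow> V" where
  "gen_op GenX = op_s"
| "gen_op GenY = op_t"

text \<open>The head of the list acts first, as operators act on the right; concatenation thus
  becomes the product of \<open>End_V\<close>.\<close>

fun list_op :: "gen list \<Rightarrow> V \<Rightarrow> V" where
  "list_op [] = id"
| "list_op (g # l) = list_op l \<circ> gen_op g"

fun mon_op :: "gen free_monoid \<Rightarrow> V \<Rightarrow> V" where
  "mon_op (FWord l) = list_op l"

definition eval_op :: "(gen free_monoid \<Rightarrow>\<^sub>0 int) \<Rightarrow> V \<Rightarrow> V" where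
  "eval_op f v =
    (\<Sum>w\<in>Poly_Mapping.keys f. scale (of_int (poly_mapping.lookup f w)) (mon_op w v))"

lemma linear_gen_op: "Vector_Spaces.linear scale scale (gen_op g)"
  by (cases g) (simp_all add: op_s_def op_t_def linear_lin_ext)

lemma linear_list_op: "Vector_Spaces.linear scale scale (list_op l)"
  by (induction l) (use linear_gen_op in \<open>auto simp: linear_iff_V\<close>)

lemma linear_mon_op: "Vector_Spaces.linear scale scale (mon_op w)"
  by (cases w) (simp add: linear_list_op)

lemma mon_op_add: "mon_op w (v + v') = mon_op w v + mon_op w v'"
  and mon_op_scale: "mon_op w (scale c v) = scale c (mon_op w v)"
  using linear_mon_op[of w] by (simp_all add: linear_iff_V)

lemma list_op_append: "list_op (k @ l) = list_op l \<circ> list_op k"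
  by (induction k) (simp_all add: comp_assoc)

lemma mon_op_plus: "mon_op (w + w') = mon_op w' \<circ> mon_op w"
  by (cases w; cases w') (simp add: list_op_append)

lemma eval_op_superset:
  assumes "finite A" "Poly_Mapping.keys f \<subseteq> A"
  shows "eval_op f v = (\<Sum>w\<in>A. scale (of_int (poly_mapping.lookup f w)) (mon_op w v))"
  unfolding eval_op_def using assms
  by (intro sum.mono_neutral_left) (auto simp: in_keys_iff)

lemma eval_op_0: "eval_op 0 v = 0"
  by (simp add: eval_op_def)

lemma eval_op_add: "eval_op (f + g) v = eval_op f v + eval_op g v"
proof -
  let ?A = "Poly_Mapping.keys f \<union> Poly_Mapping.keys g"
  have "Poly_Mapping.keys (f + g) \<subseteq> ?A" by (rule Poly_Mapping.keys_add)
  then show ?thesis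
    by (simp add: eval_op_superset[of ?A] lookup_add V.scale_left_distrib sum.distrib)
qed

lemma eval_op_diff: "eval_op (f - g) v = eval_op f v - eval_op g v"
  using eval_op_add[of "f - g" g v] by simp

lemma eval_op_minus: "eval_op (- f) v = - eval_op f v"
  using eval_op_diff[of 0 f v] by (simp add: eval_op_0)

lemma eval_op_single: "eval_op (Poly_Mapping.single w 1) = mon_op w"
  by (simp add: eval_op_def fun_eq_iff)

lemma linear_eval_op: "Vector_Spaces.linear scale scale (eval_op f)"
  unfolding linear_iff_V
  by (simp add: eval_op_def mon_op_add mon_op_scale V.scale_right_distrib sum.distrib
      V.scale_sum_right mult.commute)

lemma eval_op_diff_right: "eval_op f (v - v') = eval_op f v - eval_op f v'"
proof -
  have "eval_op f (v - v' + v') = eval_op f (v - v') + eval_op f v'"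
    using linear_eval_op[of f] unfolding linear_iff_V by blast
  then show ?thesis by simp
qed

lemma eval_op_zero_right: "eval_op f 0 = 0"
  using eval_op_diff_right[of f 0 0] by simp

text \<open>Both sides are additive in \<open>f\<close> and in \<open>g\<close>, so the claim
  reduces to monomials, where it is \<open>mon_op_plus\<close>.\<close>

lemma eval_op_mult: "eval_op (f * g) v = eval_op g (eval_op f v)"
proof -
  have single: "eval_op (Poly_Mapping.single w 1 * g) v = eval_op g (mon_op w v)" for w v
    by (rule frag_induction[of g UNIV])
      (simp_all add: eval_op_0 eval_op_diff right_diff_distrib mult_single eval_op_single
        mon_op_plus)
  show ?thesis
    by (rule frag_induction[of f UNIV])
      (simp_all add: eval_op_0 eval_op_diff left_diff_distrib eval_op_single single
        eval_op_zero_right eval_op_diff_right)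
qed

lemma free_ring_simps:
  "carrier free_ring = UNIV" "monoid.mult free_ring f g = f * g" "add free_ring f g = f + g"
  "one free_ring = 1" "ring.zero free_ring = 0"
  by (simp_all add: free_ring_def ring_of_type_algebra_def)

lemma End_V_simps:
  "carrier End_V = {f. Vector_Spaces.linear scale scale f}" "monoid.mult End_V f g = g \<circ> f"
  "add End_V f g = (\<lambda>v. f v + g v)" "one End_V = id" "ring.zero End_V = (\<lambda>v. 0)"
  by (simp_all add: End_V_def)

lemma eval_op_one: "eval_op 1 = id"
proof -
  have "(1 :: gen free_monoid \<Rightarrow>\<^sub>0 int) = Poly_Mapping.single (FWord []) 1"
    by (metis single_one zero_free_monoid_def)
  then have "eval_op 1 = mon_op (FWord [])" by (metis eval_op_single)
  then show ?thesis by simp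
qed

lemma eval_op_ring_hom: "eval_op \<in> ring_hom free_ring End_V"
  by (rule ring_hom_memI)
    (simp_all add: free_ring_simps End_V_simps linear_eval_op eval_op_mult eval_op_add
      eval_op_one fun_eq_iff)

lemma range_eval_op: "range eval_op = generate_ring End_V {op_s, op_t}"
proof
  interpret E: ring End_V by (rule ring_End_V)
  let ?G = "generate_ring End_V {op_s, op_t}"
  have sub: "subring ?G End_V"
    using op_s_op_t_in_End_V by (intro E.generate_ring_is_subring) auto
  have gen: "gen_op g \<in> ?G" for g
    by (cases g) (auto intro: generate_ring.incl)
  have list: "list_op l \<in> ?G" for l
  proof (induction l)
    case Nil
    show ?case using generate_ring.one[of End_V] by (metis End_V_simps(4) list_op.simps(1))
  next
    case (Cons g l)
    then show ?case
      using generate_ring.eng_mult[OF gen[of g] Cons]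
      by (metis End_V_simps(2) list_op.simps(2))
  qed
  have "eval_op f \<in> ?G" for f
  proof (rule frag_induction[of f UNIV])
    show "eval_op 0 \<in> ?G"
    proof -
      have "eval_op 0 = \<zero>\<^bsub>End_V\<^esub>" by (simp add: End_V_simps eval_op_0 fun_eq_iff)
      then show ?thesis using subringE(2)[OF sub] by simp
    qed
  next
    fix w show "eval_op (frag_of w) \<in> ?G"
      using list by (cases w) (simp add: eval_op_single)
  next
    fix f g assume fg: "eval_op f \<in> ?G" "eval_op g \<in> ?G"
    have "\<ominus>\<^bsub>End_V\<^esub> eval_op g = eval_op (- g)"
      by (rule E.minus_equality) (simp_all add: End_V_simps linear_eval_op eval_op_minus)
    then have "eval_op (f - g) = eval_op f \<oplus>\<^bsub>End_V\<^esub> \<ominus>\<^bsub>End_V\<^esub> eval_op g"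
      by (simp add: End_V_simps eval_op_diff eval_op_minus fun_eq_iff)
    then show "eval_op (f - g) \<in> ?G"
      using fg by (simp add: generate_ring.a_inv generate_ring.eng_add)
  qed simp
  then show "range eval_op \<subseteq> ?G" by auto
next
  interpret E: ring End_V by (rule ring_End_V)
  interpret F: ring free_ring by (rule ring_free_ring)
  interpret H: ring_hom_ring free_ring End_V eval_op
    by (intro ring_hom_ringI2 ring_free_ring ring_End_V eval_op_ring_hom)
  \<comment> \<open>The image of a ring homomorphism is a subring; once it contains both generators,
    it contains the subring they generate.\<close>
  have "subring (eval_op ` carrier free_ring) End_V"
    by (intro H.img_is_subring F.carrier_is_subring)
  moreover have "op_s = eval_op (Poly_Mapping.single (FWord [GenX]) 1)"
    "op_t = eval_op (Poly_Mapping.single (FWord [GenY]) 1)"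
    by (simp_all add: eval_op_single)
  ultimately show "generate_ring End_V {op_s, op_t} \<subseteq> range eval_op"
    using op_s_op_t_in_End_V
    by (intro E.generate_ring_min_subring1) (simp_all add: free_ring_simps)
qed

subsection \<open>The action on staircase words\<close>

text \<open>
  The block lengths are chosen such that, starting from \<open>stair K i n\<close>, applying \<^term>\<open>op_t\<close>
  \<open>j\<close> times gives a leading block of length \<open>K (i + j)\<close>.
\<close>

fun stair_tail :: "(nat \<Rightarrow> nat) \<Rightarrow> nat \<Rightarrow> nat \<Rightarrow> letter list" where
  "stair_tail K i 0 = []"
| "stair_tail K i (Suc n) =
    Y1 # replicate (K (Suc i) - Suc (K i)) Y2 @ stair_tail K (Suc i) n"

definition stair :: "(nat \<Rightarrow> nat) \<Rightarrow> nat \<Rightarrow> nat \<Rightarrow> letter list" where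
  "stair K i n = replicate (K i) Y2 @ stair_tail K i n"

text \<open>The exponent of 2 that a monomial picks up on \<open>stair K i n\<close>;
  \<open>GenY\<close> counts the block length after the merge.\<close>

fun weight :: "(nat \<Rightarrow> nat) \<Rightarrow> nat \<Rightarrow> gen list \<Rightarrow> nat" where
  "weight K i [] = 0"
| "weight K i (GenX # l) = K i + weight K i l"
| "weight K i (GenY # l) = K (Suc i) + weight K (Suc i) l"

lemma prefix_scale_word: "prefix y (scale c (word u)) = scale c (word (y # u))"
  using linear_lin_ext[of "\<lambda>u. word (y # u)"]
  by (simp add: prefix_def linear_iff_V)

text \<open>The assumption says that \<open>u\<close> is empty or starts with \<open>Y1\<close>,
  where the recursion for \<open>s\<close> stops.\<close>

lemma s_word_replicate:
  assumes "s_word u = word u"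
  shows "s_word (replicate k Y2 @ u) = scale (2 ^ k) (word (replicate k Y2 @ u))"
  by (induction k) (simp_all add: assms prefix_scale_word)

text \<open>Each leading \<open>Y2\<close> gives a factor 2, and so does turning \<open>Y1\<close>
  into \<open>Y2\<close>; the rest is left to \<open>s\<close>, which adds
  \<open>2 ^ l\<close>.\<close>

lemma t_word_replicate:
  assumes "s_word u = word u"
  shows "t_word (replicate k Y2 @ Y1 # replicate l Y2 @ u) =
    scale (2 ^ (Suc k + l)) (word (replicate (Suc k + l) Y2 @ u))"
  by (induction k) (simp_all add: s_word_replicate assms prefix_scale_word)

lemma s_word_stair_tail: "s_word (stair_tail K i n) = word (stair_tail K i n)"
  by (cases n) simp_all

lemma op_s_stair: "op_s (word (stair K i n)) = scale (2 ^ K i) (word (stair K i n))"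
  by (simp add: op_s_def stair_def s_word_replicate s_word_stair_tail)

lemma op_t_stair:
  assumes "strict_mono K"
  shows "op_t (word (stair K i (Suc n))) =
    scale (2 ^ K (Suc i)) (word (stair K (Suc i) n))"
proof -
  \<comment> \<open>The inner \<open>Suc\<close> is the \<open>Y1\<close> turned into
    \<open>Y2\<close>; strict monotonicity keeps the truncated subtraction exact.\<close>
  have "Suc (K i) + (K (Suc i) - Suc (K i)) = K (Suc i)"
    using strict_monoD[OF assms, of i "Suc i"] by simp
  then show ?thesis
    by (simp add: op_t_def stair_def t_word_replicate s_word_stair_tail
        del: add_Suc replicate_Suc power_Suc)
qed

text \<open>Each \<open>GenY\<close> uses up one \<open>Y1\<close>, hence the bound on the length.
  Only the exponent matters later, so \<open>u\<close> stays unspecified.\<close>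

lemma list_op_stair:
  assumes "strict_mono K" "length l \<le> n"
  shows "\<exists>u. list_op l (word (stair K i n)) = scale (2 ^ weight K i l) (word u)"
  using assms
proof (induction K i l arbitrary: n rule: weight.induct)
  case (1 K i)
  then show ?case by (auto intro: exI[of _ "stair K i n"])
next
  case (2 K i l)
  then obtain u where "list_op l (word (stair K i n)) = scale (2 ^ weight K i l) (word u)"
    by fastforce
  then show ?case
    using linear_list_op[of l] by (auto simp: op_s_stair linear_iff_V power_add)
next
  case (3 K i l)
  then obtain m where m: "n = Suc m" "length l \<le> m"
    by (cases n) auto
  with 3 obtain u
    where "list_op l (word (stair K (Suc i) m)) = scale (2 ^ weight K (Suc i) l) (word u)"
    by blast
  then show ?case
    using linear_list_op[of l] "3.prems"(1) m
    by (auto simp: op_t_stair linear_iff_V power_add)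
qed

subsection \<open>Faithfulness\<close>

lemma weight_mult: "weight (\<lambda>i. M * K i) i l = M * weight K i l"
  by (induction K i l rule: weight.induct) (simp_all add: algebra_simps)

text \<open>The witness \<open>a\<close> is the number of \<open>GenX\<close> before the first
  \<open>GenY\<close>; all later letters contribute multiples of \<open>D ^ Suc i\<close>.\<close>

lemma weight_power_digit:
  "\<exists>a q. weight (\<lambda>i. D ^ i) i l = D ^ i * a + D ^ Suc i * q \<and> a \<le> length l"
proof (induction "\<lambda>i. D ^ i" i l rule: weight.induct)
  case (1 i)
  show ?case by simp
next
  case (2 i l)
  then obtain a q
    where "weight (\<lambda>i. D ^ i) i l = D ^ i * a + D ^ Suc i * q" "a \<le> length l"
    by blast
  then show ?case by (intro exI[of _ "Suc a"] exI[of _ q]) simp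
next
  case (3 i l)
  then obtain a q
    where "weight (\<lambda>i. D ^ i) (Suc i) l = D ^ Suc i * a + D ^ Suc (Suc i) * q"
    by blast
  then show ?case
    by (intro exI[of _ 0] exI[of _ "Suc a + D * q"]) (simp add: algebra_simps)
qed

text \<open>The digit at \<open>D ^ i\<close> is 0 after a leading \<open>GenY\<close>, but lies
  strictly between 0 and \<open>D\<close> after a leading \<open>GenX\<close>.\<close>

lemma weight_GenX_neq_GenY:
  assumes "Suc (length l) < D"
  shows "weight (\<lambda>i. D ^ i) i (GenX # l) \<noteq> weight (\<lambda>i. D ^ i) i (GenY # l')"
proof
  assume eq: "weight (\<lambda>i. D ^ i) i (GenX # l) = weight (\<lambda>i. D ^ i) i (GenY # l')"
  obtain a q where a: "weight (\<lambda>i. D ^ i) i l = D ^ i * a + D ^ Suc i * q" "a \<le> length l"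
    using weight_power_digit by blast
  obtain a' q' where a': "weight (\<lambda>i. D ^ i) (Suc i) l' = D ^ Suc i * a' + D ^ Suc (Suc i) * q'"
    using weight_power_digit by blast
  have "D ^ i * (Suc a + D * q) = D ^ i * (D * Suc (a' + D * q'))"
    using eq a a' by (simp add: algebra_simps)
  then have "Suc a + D * q = D * Suc (a' + D * q')"
    using assms by (simp only: mult_cancel1) simp
  then have "D dvd Suc a" by (metis dvd_triv_left dvd_add_left_iff)
  then show False using a(2) assms by (auto dest: dvd_imp_le)
qed

text \<open>The lowest digit determines the first letter; cancelling its contribution leaves the
  tails, at index \<open>i\<close> or \<open>Suc i\<close>.\<close>

lemma weight_power_inj:
  assumes "length l < D" "length l' < D"
    and "weight (\<lambda>i. D ^ i) i l = weight (\<lambda>i. D ^ i) i l'"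
  shows "l = l'"
  using assms
proof (induction l arbitrary: i l')
  case Nil
  show ?case
  proof (cases l')
    case (Cons g k)
    then show ?thesis using Nil by (cases g) auto
  qed simp
next
  case (Cons g k)
  show ?case
  proof (cases l')
    case Nil
    then show ?thesis using Cons.prems by (cases g) auto
  next
    case l': (Cons g' k')
    have "g = g'"
    proof (cases g; cases g')
      assume "g = GenX" "g' = GenY"
      then show ?thesis using weight_GenX_neq_GenY[of k D i k'] Cons.prems l' by simp
    next
      assume "g = GenY" "g' = GenX"
      then show ?thesis using weight_GenX_neq_GenY[of k' D i k] Cons.prems l' by simp
    qed simp_all
    moreover have "weight (\<lambda>i. D ^ i) j k = weight (\<lambda>i. D ^ i) j k'"
      if "j = (if g = GenX then i else Suc i)" for j
      using Cons.prems l' \<open>g = g'\<close> that by (cases g) simp_all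
    ultimately show ?thesis using Cons.IH Cons.prems l' by auto
  qed
qed

text \<open>At the least exponent with a nonzero coefficient, all other terms are divisible by one
  more power of \<open>b\<close>, so \<open>b\<close> divides a nonzero number smaller than itself
  in absolute value.\<close>

lemma power_sum_eq_0:
  fixes c :: "'a \<Rightarrow> int"
  assumes "finite A" "inj_on e A" "\<And>w. w \<in> A \<Longrightarrow> \<bar>c w\<bar> < b"
    and sum: "(\<Sum>w\<in>A. c w * b ^ e w) = 0" and "w \<in> A"
  shows "c w = 0"
proof (rule ccontr)
  assume "c w \<noteq> 0"
  define B where "B = {w \<in> A. c w \<noteq> 0}"
  have B: "finite B" "w \<in> B" using assms \<open>c w \<noteq> 0\<close> by (auto simp: B_def)
  obtain m where m: "m \<in> B" "\<And>w. w \<in> B \<Longrightarrow> e m \<le> e w"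
    using ex_has_least_nat[of "\<lambda>w. w \<in> B" w e] B by blast
  have b: "b > 0" using assms(3)[OF \<open>w \<in> A\<close>] by linarith
  have "b ^ Suc (e m) dvd (\<Sum>w\<in>B - {m}. c w * b ^ e w)"
  proof (rule dvd_sum)
    fix w assume w: "w \<in> B - {m}"
    then have "e w \<noteq> e m" using m(1) assms(2) by (auto simp: B_def inj_on_def)
    with m(2)[of w] w have "Suc (e m) \<le> e w" by auto
    then show "b ^ Suc (e m) dvd c w * b ^ e w" by (intro dvd_mult le_imp_power_dvd)
  qed
  moreover have "(\<Sum>w\<in>B. c w * b ^ e w) = 0"
    using sum sum.mono_neutral_left[of A B "\<lambda>w. c w * b ^ e w"] assms(1)
    by (auto simp: B_def)
  ultimately have "b ^ Suc (e m) dvd c m * b ^ e m"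
    using sum.remove[OF B(1) m(1), of "\<lambda>w. c w * b ^ e w"]
    by (metis add.inverse_unique dvd_minus_iff add.commute)
  then have "b dvd c m" using b by simp
  moreover have "c m \<noteq> 0" "\<bar>c m\<bar> < b" using m(1) assms(3) by (auto simp: B_def)
  ultimately show False using dvd_imp_le_int[of "c m" b] by simp
qed

lemma eval_op_eq_0:
  assumes "eval_op f = (\<lambda>v. 0)"
  shows "f = 0"
proof -
  define A where "A = Poly_Mapping.keys f"
  define c where "c = poly_mapping.lookup f"
  define len where "len = (\<lambda>FWord (l :: gen list) \<Rightarrow> length l)"
  \<comment> \<open>\<open>D\<close> exceeds all degrees and is at least 2; with \<open>M\<close>
    positive this makes \<open>K\<close> strictly increasing.\<close>
  define D where "D = Suc (Suc (\<Sum>w\<in>A. len w))"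
  define M where "M = Suc (\<Sum>w\<in>A. nat \<bar>c w\<bar>)"
  define K where "K = (\<lambda>i. M * D ^ i)"
  define e where "e = (\<lambda>FWord l \<Rightarrow> weight (\<lambda>i. D ^ i) 0 l)"
  define v where "v = word (stair K 0 D)"
  \<comment> \<open>The sum of coefficients, as a multiple of the empty word: \<open>C\<close>
    forgets which word a monomial produces.\<close>
  define C where "C = lin_ext (\<lambda>u. word [])"
  interpret C: Vector_Spaces.linear scale scale C
    unfolding C_def by (rule linear_lin_ext)
  have fin: "finite A" by (simp add: A_def)
  have len: "len w < D" if "w \<in> A" for w
    using member_le_sum[OF that, of len] fin by (simp add: D_def)
  have "strict_mono K"
    unfolding K_def
    by (intro strict_monoI mult_strict_left_mono power_strict_increasing)
      (simp_all add: M_def D_def)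
  have mon: "C (mon_op w v) = scale ((2 ^ M) ^ e w) (word [])" if w: "w \<in> A" for w
  proof -
    obtain l where l: "w = FWord l" by (cases w)
    then have "length l \<le> D" using len[OF w] by (simp add: len_def)
    from list_op_stair[OF \<open>strict_mono K\<close> this, of 0] obtain u
      where "list_op l v = scale (2 ^ weight K 0 l) (word u)" unfolding v_def by blast
    moreover have "weight K 0 l = M * e w"
      using weight_mult[of M "\<lambda>i. D ^ i" 0 l] by (simp add: K_def e_def l)
    ultimately show ?thesis by (simp add: l C.scale power_mult) (simp add: C_def)
  qed
  have "(\<Sum>w\<in>A. scale (of_int (c w)) (scale ((2 ^ M) ^ e w) (word []))) = C (eval_op f v)"
    by (simp add: eval_op_def C.sum C.scale mon A_def[symmetric] c_def)
  also have "\<dots> = 0" by (simp add: assms C.zero)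
  finally have "poly_mapping.lookup
      (\<Sum>w\<in>A. scale (of_int (c w)) (scale ((2 ^ M) ^ e w) (word []))) [] = 0"
    by simp
  then have "of_int (\<Sum>w\<in>A. c w * (2 ^ M) ^ e w) = (0 :: rat)"
    by (simp add: lookup_sum word_def)
  then have sum: "(\<Sum>w\<in>A. c w * (2 ^ M) ^ e w) = 0" by (simp only: of_int_eq_0_iff)
  have inj: "inj_on e A"
  proof (rule inj_onI)
    fix w w' assume w: "w \<in> A" "w' \<in> A" "e w = e w'"
    obtain l l' where l: "w = FWord l" "w' = FWord l'" by (cases w; cases w')
    have "l = l'"
    proof (rule weight_power_inj)
      show "length l < D" "length l' < D"
        using len[OF w(1)] len[OF w(2)] by (simp_all add: l len_def)
      show "weight (\<lambda>i. D ^ i) 0 l = weight (\<lambda>i. D ^ i) 0 l'"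
        using w(3) by (simp add: l e_def)
    qed
    then show "w = w'" by (simp add: l)
  qed
  have bound: "\<bar>c w\<bar> < 2 ^ M" if "w \<in> A" for w
  proof -
    have "nat \<bar>c w\<bar> < M"
      using member_le_sum[OF that, of "\<lambda>w. nat \<bar>c w\<bar>"] fin by (simp add: M_def)
    also have "M < 2 ^ M" by (rule less_exp)
    finally show ?thesis by (simp add: nat_less_iff)
  qed
  have "c w = 0" if "w \<in> A" for w
    using fin inj bound sum that by (rule power_sum_eq_0)
  moreover have "c w \<noteq> 0" if "w \<in> A" for w
    using that by (simp add: A_def c_def in_keys_iff)
  ultimately have "A = {}" by blast
  then show "f = 0" by (simp add: A_def)
qed

theorem theorem1:
  shows "R1 \<simeq> (free_ring :: (gen free_monoid \<Rightarrow>\<^sub>0 int) ring)"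
proof -
  let ?F = "free_ring :: (gen free_monoid \<Rightarrow>\<^sub>0 int) ring"
  have "inj eval_op"
  proof (rule injI)
    fix f g assume "eval_op f = eval_op g"
    then have "f - g = 0" by (intro eval_op_eq_0) (simp add: fun_eq_iff eval_op_diff)
    then show "f = g" by simp
  qed
  then have "bij_betw eval_op (carrier ?F) (carrier R1)"
    by (simp add: bij_betw_def R1_def free_ring_simps range_eval_op)
  moreover have "eval_op \<in> ring_hom ?F R1"
    using eval_op_ring_hom range_eval_op
    by (auto simp: ring_hom_def R1_def free_ring_simps)
  ultimately have "eval_op \<in> ring_iso ?F R1" by (simp add: ring_iso_def)
  then have "?F \<simeq> R1" unfolding is_ring_iso_def by blast
  then show ?thesis by (rule ring_iso_sym[OF ring_free_ring])
qed

end
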